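(* Let $n\ge1$ and let $T$ be a semistandard Young tableau of type $A_n$ with shape $\lambda$. Then $$\varphi_T(t)=\prod_{u}\bigl(1-t^{|h(u)|}\bigr),$$ where the product runs over all boxes $u$ of $T$ for which there is no box $v\in h(u)$ with $c(v)=c(u)$.
   Context: The alphabet is $\{1<\dots<n+1\}$. A Young tableau of type $A_n$ of shape $\lambda$ is the left-aligned diagram of a partition $\lambda=(\lambda_1\ge\dots\ge\lambda_k>0)$ with $k\le n$ rows, filled with letters strictly increasing down columns. It is semistandard if entries weakly increase along rows. Write $c(u)$ for the entry of a box $u$. For a partition $\nu$ let $\nu'_j$ be the number of boxes in the $j$-th column of its diagram, with columns numbered $1,2,\dots$ from the left, and let $m_j(\nu)=\nu'_j-\nu'_{j+1}$. For $a=0,\dots,n+1$ let $\lambda^{(a)}$ be the shape formed by the boxes of $T$ with entries $\le a$, so $\lambda^{(0)}\subset\dots\subset\lambda^{(n+1)}=\lambda$. For partitions $\nu\supset\kappa$ let $\theta'_j=\nu'_j-\kappa'_j$, let $I=\{j\ge1:\theta'_j>\theta'_{j+1}\}$, and set $$\varphi_{\nu/\kappa}(t)=\prod_{j\in I}\bigl(1-t^{m_j(\nu)}\bigr).$$ Define $$\varphi_T(t)=\prod_{a=1}^{n+1}\varphi_{\lambda^{(a)}/\lambda^{(a-1)}}(t).$$ The augmented tableau $\hat T$ is obtained from $T$ by appending one box filled with $\infty$ at the right end of each row, where $a<\infty$ for all letters $a$. For a box $u$ of $T$ in row $j$ and some column, its head $h(u)$ is the set of boxes $v$ of $\hat T$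 in the next column to the right, in rows $\le j$, with $c(u)\le c(v)$. *)

theory Defs
  imports Main "HOL-Library.Extended_Nat"
begin

text \<open>A box is a pair (row, column), both numbered from 1; rows are numbered from the top.\<close>

type_synonym box = "nat \<times> nat"

definition is_partition :: "nat list \<Rightarrow> bool" where
  "is_partition lam \<longleftrightarrow> sorted_wrt (\<ge>) lam \<and> (\<forall>p \<in> set lam. 0 < p)"

definition diagram :: "nat list \<Rightarrow> box set" where
  "diagram lam = {(i, j). 1 \<le> i \<and> i \<le> length lam \<and> 1 \<le> j \<and> j \<le> lam ! (i - 1)}"

text \<open>A filling is a total function on boxes; only its values on the diagram are ever used.\<close>

definition young_tableau :: "nat \<Rightarrow> nat list \<Rightarrow> (box \<Rightarrow> nat) \<Rightarrow> bool" where
  "young_tableau n lam T \<longleftrightarrow>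
     is_partition lam \<and> length lam \<le> n \<and>
     (\<forall>u \<in> diagram lam. T u \<in> {1..n + 1}) \<and>
     (\<forall>i i' j. (i, j) \<in> diagram lam \<longrightarrow> (i', j) \<in> diagram lam \<longrightarrow> i < i' \<longrightarrow> T (i, j) < T (i', j))"

definition semistandard_tableau :: "nat \<Rightarrow> nat list \<Rightarrow> (box \<Rightarrow> nat) \<Rightarrow> bool" where
  "semistandard_tableau n lam T \<longleftrightarrow>
     young_tableau n lam T \<and>
     (\<forall>i j j'. (i, j) \<in> diagram lam \<longrightarrow> (i, j') \<in> diagram lam \<longrightarrow> j < j' \<longrightarrow> T (i, j) \<le> T (i, j'))"

text \<open>From here on shapes are given by their diagrams. In \<open>col_mult\<close> the natural-number
  subtraction never truncates on the diagram of a partition.\<close>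

definition col_length :: "box set \<Rightarrow> nat \<Rightarrow> nat" where
  "col_length D j = card {i. (i, j) \<in> D}"

definition col_mult :: "box set \<Rightarrow> nat \<Rightarrow> nat" where
  "col_mult D j = col_length D j - col_length D (j + 1)"

definition skew_col_length :: "box set \<Rightarrow> box set \<Rightarrow> nat \<Rightarrow> int" where
  "skew_col_length D E j = int (col_length D j) - int (col_length E j)"

definition phi_skew :: "box set \<Rightarrow> box set \<Rightarrow> 'a::comm_ring_1 \<Rightarrow> 'a" where
  "phi_skew D E t =
     (\<Prod>j \<in> {j. 1 \<le> j \<and> skew_col_length D E j > skew_col_length D E (j + 1)}. 1 - t ^ col_mult D j)"

definition subshape :: "nat list \<Rightarrow> (box \<Rightarrow> nat) \<Rightarrow> nat \<Rightarrow> box set" where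
  "subshape lam T a = {u \<in> diagram lam. T u \<le> a}"

definition phi_tableau :: "nat \<Rightarrow> nat list \<Rightarrow> (box \<Rightarrow> nat) \<Rightarrow> 'a::comm_ring_1 \<Rightarrow> 'a" where
  "phi_tableau n lam T t = (\<Prod>a = 1..n + 1. phi_skew (subshape lam T a) (subshape lam T (a - 1)) t)"

definition aug_diagram :: "nat list \<Rightarrow> box set" where
  "aug_diagram lam = diagram lam \<union> {(i, lam ! (i - 1) + 1) | i. 1 \<le> i \<and> i \<le> length lam}"

definition aug_entry :: "nat list \<Rightarrow> (box \<Rightarrow> nat) \<Rightarrow> box \<Rightarrow> enat" where
  "aug_entry lam T v = (if v \<in> diagram lam then enat (T v) else \<infinity>)"

definition head :: "nat list \<Rightarrow> (box \<Rightarrow> nat) \<Rightarrow> box \<Rightarrow> box set" where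
  "head lam T u = {v \<in> aug_diagram lam.
     snd v = snd u + 1 \<and> fst v \<le> fst u \<and> aug_entry lam T u \<le> aug_entry lam T v}"

end

theory Submission imports Defs begin

text \<open>A column contains each letter \<open>a\<close> at most once, so the \<open>j\<close>-th factor of
  \<open>phi_skew\<close> for the letter \<open>a\<close> is present iff \<open>a\<close> occurs in column \<open>j\<close> but not in column \<open>j + 1\<close>.
  Such pairs \<open>(a, j)\<close> correspond to the boxes \<open>u\<close> of the right-hand product, because an equal entry
  in the next column automatically lies weakly above \<open>u\<close>. If \<open>u\<close> lies in row \<open>i\<close>, then column \<open>j\<close> of
  \<open>subshape lam T a\<close> has length \<open>i\<close>, column \<open>j + 1\<close> of it is contained in the first \<open>i\<close> rows, and the
  head of \<open>u\<close> consists of the remaining boxes of the augmented column \<open>j + 1\<close> in these rows.\<close>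

lemma finite_diagram: "finite (diagram lam)"
proof -
  have "diagram lam \<subseteq> (SIGMA i:{1..length lam}. {1..lam ! (i - 1)})"
    by (auto simp: diagram_def)
  then show ?thesis
    by (rule finite_subset) auto
qed

lemma finite_column:
  assumes "finite D" shows "finite {i. (i, j) \<in> D}"
  using finite_vimageI[OF assms, of "\<lambda>i. (i, j)"] by (auto simp: vimage_def inj_on_def)

lemma diagram_pos: "(i, j) \<in> diagram lam \<Longrightarrow> 1 \<le> i \<and> 1 \<le> j"
  by (auto simp: diagram_def)

lemma is_partition_antimono:
  assumes "is_partition lam" "1 \<le> r" "r \<le> i" "i \<le> length lam"
  shows "lam ! (i - 1) \<le> lam ! (r - 1)"
proof (cases "r = i")
  case False
  then show ?thesis
    using assms sorted_wrt_nth_less[of "(\<ge>)" lam "r - 1" "i - 1"]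
    by (auto simp: is_partition_def)
qed simp

lemma diagram_up:
  assumes "is_partition lam" "(i, j) \<in> diagram lam" "1 \<le> r" "r \<le> i"
  shows "(r, j) \<in> diagram lam"
  using assms is_partition_antimono[of lam r i] by (auto simp: diagram_def)

lemma diagram_left:
  "(i, j) \<in> diagram lam \<Longrightarrow> 1 \<le> j' \<Longrightarrow> j' \<le> j \<Longrightarrow> (i, j') \<in> diagram lam"
  by (auto simp: diagram_def)

text \<open>Row \<open>r\<close> is at least as long as row \<open>i\<close>, so it reaches column
  \<open>j\<close>. One step further is either still in the diagram or the appended box that ends
  the row.\<close>

lemma aug_diagram_next_column:
  assumes "is_partition lam" "(i, j) \<in> diagram lam" "1 \<le> r" "r \<le> i"
  shows "(r, j + 1) \<in> aug_diagram lam"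
  using assms is_partition_antimono[of lam r i]
  by (auto simp: diagram_def aug_diagram_def)

context
  fixes n :: nat and lam :: "nat list" and T :: "box \<Rightarrow> nat"
  assumes ss: "semistandard_tableau n lam T"
begin

lemma part: "is_partition lam"
  and T_range: "u \<in> diagram lam \<Longrightarrow> T u \<in> {1..n + 1}"
  and T_column: "\<lbrakk>(i, j) \<in> diagram lam; (i', j) \<in> diagram lam; i < i'\<rbrakk> \<Longrightarrow> T (i, j) < T (i', j)"
  and T_row: "\<lbrakk>(i, j) \<in> diagram lam; (i, j') \<in> diagram lam; j < j'\<rbrakk> \<Longrightarrow> T (i, j) \<le> T (i, j')"
  using ss unfolding semistandard_tableau_def young_tableau_def by blast+

lemma T_column_inj:
  assumes "(i, j) \<in> diagram lam" "(i', j) \<in> diagram lam" "T (i, j) = T (i', j)"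
  shows "i = i'"
  using T_column[of i j i'] T_column[of i' j i] assms by (metis less_irrefl linorder_neqE_nat)

text \<open>If \<open>r\<close> were below \<open>i\<close>, the left neighbour in row
  \<open>r\<close> would give \<open>T (i, j) < T (r, j) \<le> T (r, j + 1)\<close>.\<close>

lemma next_column_above:
  assumes "(i, j) \<in> diagram lam" "(r, j + 1) \<in> diagram lam" "T (r, j + 1) \<le> T (i, j)"
  shows "r \<le> i"
proof (rule ccontr)
  assume "\<not> r \<le> i"
  moreover have "(r, j) \<in> diagram lam"
    using diagram_left[OF assms(2), of j] diagram_pos[OF assms(1)] by simp
  ultimately have "T (i, j) < T (r, j + 1)"
    using T_column[of i j r] T_row[of r j "j + 1"] assms by fastforce
  then show False using assms(3) by simp
qed

lemma skew_col_length_subshape: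
  assumes "1 \<le> a"
  shows "skew_col_length (subshape lam T a) (subshape lam T (a - 1)) j =
    of_bool (\<exists>i. (i, j) \<in> diagram lam \<and> T (i, j) = a)"
proof -
  let ?A = "{i. (i, j) \<in> subshape lam T (a - 1)}"
  let ?B = "{i. (i, j) \<in> diagram lam \<and> T (i, j) = a}"
  \<comment> \<open>Since \<open>1 \<le> a\<close>, the subtraction \<open>a - 1\<close> does not
    truncate, so an entry up to \<open>a\<close> is either at most \<open>a - 1\<close> or equal to
    \<open>a\<close>.\<close>
  have split: "{i. (i, j) \<in> subshape lam T a} = ?A \<union> ?B" "?A \<inter> ?B = {}"
    using assms by (auto simp: subshape_def)
  have fin: "finite ?A" "finite ?B"
    by (rule finite_subset[OF _ finite_column[OF finite_diagram, of j lam]];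
        auto simp: subshape_def)+
  have B: "card ?B = of_bool (\<exists>i. (i, j) \<in> diagram lam \<and> T (i, j) = a)"
  proof (cases "\<exists>i. (i, j) \<in> diagram lam \<and> T (i, j) = a")
    case True
    then obtain i where i: "(i, j) \<in> diagram lam" "T (i, j) = a" by blast
    then have "?B = {i}" using T_column_inj by blast
    with True show ?thesis by simp
  next
    case False
    then have "?B = {}" by blast
    then have "card ?B = 0" by (simp only: card.empty)
    with False show ?thesis by (simp only: of_bool_eq)
  qed
  show ?thesis
    unfolding skew_col_length_def col_length_def split(1) card_Un_disjoint[OF fin split(2)] B
    by simp
qed

text \<open>Both differences are 0 or 1, so a strict drop means 1 followed by 0. The bound
  \<open>1 \<le> j\<close> is absorbed because boxes of the diagram have positive columns.\<close>

lemma phi_skew_index_set: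
  assumes "1 \<le> a"
  shows "{j. 1 \<le> j \<and> skew_col_length (subshape lam T a) (subshape lam T (a - 1)) j
      > skew_col_length (subshape lam T a) (subshape lam T (a - 1)) (j + 1)} =
    {j. (\<exists>i. (i, j) \<in> diagram lam \<and> T (i, j) = a) \<and>
      (\<forall>i. (i, j + 1) \<in> diagram lam \<longrightarrow> T (i, j + 1) \<noteq> a)}"
  unfolding skew_col_length_subshape[OF assms] using diagram_pos by (auto; blast)

text \<open>An appended box carries \<infinity> and never equals the finite entry of a box of
  \<open>T\<close>; an equal entry in the next column satisfies the row bound of the head by
  \<open>next_column_above\<close>.\<close>

lemma no_equal_in_head_iff:
  assumes "(i, j) \<in> diagram lam"
  shows "(\<exists>v \<in> head lam T (i, j). aug_entry lam T v = aug_entry lam T (i, j)) \<longleftrightarrow>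
    (\<exists>r. (r, j + 1) \<in> diagram lam \<and> T (r, j + 1) = T (i, j))" (is "?L \<longleftrightarrow> ?R")
proof
  assume ?L
  then show ?R using assms
    by (auto simp: head_def aug_entry_def split: if_splits)
next
  assume ?R
  then obtain r where r: "(r, j + 1) \<in> diagram lam" "T (r, j + 1) = T (i, j)" by blast
  then have "r \<le> i" using next_column_above[OF assms] by simp
  then have "(r, j + 1) \<in> head lam T (i, j)"
    using r assms by (auto simp: head_def aug_diagram_def aug_entry_def)
  then show ?L using r assms by (force simp: aug_entry_def)
qed

lemma card_head:
  assumes u: "(i, j) \<in> diagram lam"
    and new: "\<And>r. (r, j + 1) \<in> diagram lam \<Longrightarrow> T (r, j + 1) \<noteq> T (i, j)"
  shows "card (head lam T (i, j)) = col_mult (subshape lam T (T (i, j))) j"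
proof -
  let ?S = "subshape lam T (T (i, j))"
  \<comment> \<open>Column \<open>j\<close> increases strictly downwards and has no gap above row
    \<open>i\<close>.\<close>
  have col: "{r. (r, j) \<in> ?S} = {1..i}"
  proof (intro set_eqI iffI)
    fix r assume "r \<in> {r. (r, j) \<in> ?S}"
    then have "(r, j) \<in> diagram lam" "T (r, j) \<le> T (i, j)" by (auto simp: subshape_def)
    then show "r \<in> {1..i}"
      using T_column[of i j r] u diagram_pos[of r j] by (fastforce simp: not_less[symmetric])
  next
    fix r assume r: "r \<in> {1..i}"
    then have "(r, j) \<in> diagram lam" using diagram_up[OF part u] by simp
    moreover have "T (r, j) \<le> T (i, j)"
      using T_column[of r j i] u calculation r by (cases "r = i") auto
    ultimately show "r \<in> {r. (r, j) \<in> ?S}" by (simp add: subshape_def)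
  qed
  have sub: "{r. (r, j + 1) \<in> ?S} \<subseteq> {1..i}"
    using next_column_above[OF u] diagram_pos by (auto simp: subshape_def; blast)
  have head: "head lam T (i, j) = (\<lambda>r. (r, j + 1)) ` ({1..i} - {r. (r, j + 1) \<in> ?S})"
    (is "?H = ?f ` ?R")
  proof (intro equalityI subsetI)
    fix v assume v: "v \<in> ?H"
    obtain r where r: "v = (r, j + 1)" "r \<le> i" "(r, j + 1) \<in> aug_diagram lam"
      and le: "aug_entry lam T (i, j) \<le> aug_entry lam T (r, j + 1)"
      using v by (cases v) (auto simp: head_def)
    have "1 \<le> r" using r(3) by (auto simp: aug_diagram_def diagram_def)
    \<comment> \<open>The head allows entries equal to \<open>T (i, j)\<close>, while leaving
      \<open>?S\<close> requires larger ones; \<open>new\<close> closes this gap. An appended box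
      lies outside the diagram, hence outside \<open>?S\<close>.\<close>
    moreover have "(r, j + 1) \<notin> ?S"
      using le u new[of r] by (auto simp: subshape_def aug_entry_def)
    ultimately show "v \<in> ?f ` ?R" using r by auto
  next
    fix v assume "v \<in> ?f ` ?R"
    then obtain r where "v = (r, j + 1)" "r \<in> {1..i}" "(r, j + 1) \<notin> ?S" by blast
    then have r: "v = (r, j + 1)" "1 \<le> r" "r \<le> i" "(r, j + 1) \<notin> ?S" by simp_all
    then show "v \<in> ?H"
      using aug_diagram_next_column[OF part u r(2,3)] u
      by (auto simp: head_def aug_entry_def subshape_def)
  qed
  have "card (head lam T (i, j)) = card ({1..i} - {r. (r, j + 1) \<in> ?S})"
    unfolding head by (rule card_image) (auto simp: inj_on_def)
  also have "\<dots> = card {1..i} - card {r. (r, j + 1) \<in> ?S}"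
    using sub by (intro card_Diff_subset finite_subset[OF sub]) auto
  finally show ?thesis by (simp only: col_mult_def col_length_def col)
qed

lemma phi_tableau_eq_prod_head:
  fixes t :: "'a::comm_ring_1"
  shows "phi_tableau n lam T t =
    (\<Prod>u \<in> {u \<in> diagram lam. \<not> (\<exists>v \<in> head lam T u. aug_entry lam T v = aug_entry lam T u)}.
       1 - t ^ card (head lam T u))"
proof -
  let ?J = "\<lambda>a. {j. (\<exists>i. (i, j) \<in> diagram lam \<and> T (i, j) = a) \<and>
      (\<forall>i. (i, j + 1) \<in> diagram lam \<longrightarrow> T (i, j + 1) \<noteq> a)}"
  let ?U = "{u \<in> diagram lam. \<not> (\<exists>v \<in> head lam T u. aug_entry lam T v = aug_entry lam T u)}"
  let ?F = "\<lambda>(a, j). 1 - t ^ col_mult (subshape lam T a) j"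
  have U: "?U = {(i, j). (i, j) \<in> diagram lam \<and>
      (\<forall>r. (r, j + 1) \<in> diagram lam \<longrightarrow> T (r, j + 1) \<noteq> T (i, j))}"
    using no_equal_in_head_iff by auto
  have fin: "finite (?J a)" for a
    by (rule finite_subset[OF _ finite_imageI[OF finite_diagram[of lam], of snd]]) force
  \<comment> \<open>Letter and column determine the box by \<open>T_column_inj\<close>; conversely,
    the box witnessing membership in \<open>?J a\<close> is the preimage. \<open>T_range\<close>
    ensures that the letters \<open>1..n + 1\<close> cover every box.\<close>
  have bij: "bij_betw (\<lambda>u. (T u, snd u)) ?U (SIGMA a:{1..n + 1}. ?J a)"
    unfolding bij_betw_def
  proof
    show "inj_on (\<lambda>u. (T u, snd u)) ?U"
      using T_column_inj by (auto simp: inj_on_def)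
    show "(\<lambda>u. (T u, snd u)) ` ?U = (SIGMA a:{1..n + 1}. ?J a)"
    proof (intro equalityI subsetI)
      fix x assume "x \<in> (\<lambda>u. (T u, snd u)) ` ?U"
      then show "x \<in> (SIGMA a:{1..n + 1}. ?J a)"
        unfolding U using T_range by fastforce
    next
      fix x assume "x \<in> (SIGMA a:{1..n + 1}. ?J a)"
      then obtain i j where "x = (T (i, j), j)" "(i, j) \<in> ?U"
        unfolding U by auto
      then show "x \<in> (\<lambda>u. (T u, snd u)) ` ?U" by force
    qed
  qed
  \<comment> \<open>The iterated product over letters and columns is merged into one over pairs,
    then reindexed by boxes.\<close>
  have "phi_tableau n lam T t = (\<Prod>a = 1..n + 1. \<Prod>j\<in>?J a. ?F (a, j))"
    unfolding phi_tableau_def phi_skew_def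
    by (rule prod.cong[OF refl], subst phi_skew_index_set) auto
  also have "\<dots> = (\<Prod>x\<in>(SIGMA a:{1..n + 1}. ?J a). ?F x)"
    using fin by (subst prod.Sigma) (auto simp: case_prod_beta)
  also have "\<dots> = (\<Prod>u\<in>?U. ?F (T u, snd u))"
    by (rule prod.reindex_bij_betw[OF bij, symmetric])
  also have "\<dots> = (\<Prod>u\<in>?U. 1 - t ^ card (head lam T u))"
  proof (rule prod.cong[OF refl])
    fix u assume "u \<in> ?U"
    then show "?F (T u, snd u) = 1 - t ^ card (head lam T u)"
      unfolding U using card_head by auto
  qed
  finally show ?thesis .
qed

end

theorem theorem34:
  fixes n :: nat and lam :: "nat list" and T :: "nat \<times> nat \<Rightarrow> nat" and t :: "'a::comm_ring_1"
  assumes "n \<ge> 1"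
    and "semistandard_tableau n lam T"
  shows "phi_tableau n lam T t =
    (\<Prod>u \<in> {u \<in> diagram lam. \<not> (\<exists>v \<in> head lam T u. aug_entry lam T v = aug_entry lam T u)}.
       1 - t ^ card (head lam T u))"
  using assms(2) by (rule phi_tableau_eq_prod_head)

end
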